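(* Let $1 \leq t \leq r$ be integers and let $n$ be an integer with $n \geq (r-t)\binom{3r-2t-1}{t+1} + r$. Let $1 \leq k_1 \leq k_2 \leq \dots \leq k_n$ be integers and let $\mathbf{k} := (k_1, \dots, k_n)$. Then: (i) $\mathcal{L}_{\mathbf{k},r}$ has the $t$-star property at $\{(1,1), \dots, (t,1)\}$; (ii) $\mathcal{L}_{\mathbf{k},r}$ has the strict $t$-star property.
   Context: All sets and families (sets of sets) are finite; $[n] = \{1,\dots,n\}$ and $\binom{[n]}{r}$ is the family of $r$-element subsets of $[n]$. For positive integers $k_1 \leq \dots \leq k_n$, $\mathbf{k} = (k_1,\dots,k_n)$ and $r \in [n]$, the family of labeled $r$-sets is $$\mathcal{L}_{\mathbf{k},r} := \left\{\{(x_1,y_{x_1}), \dots, (x_r,y_{x_r})\} \colon \{x_1,\dots,x_r\} \in \binom{[n]}{r},\ y_{x_i} \in \{1,\dots,k_{x_i}\} \text{ for each } i \in [r]\right\}.$$ A family $\mathcal{A}$ is $t$-intersecting if $|A \cap B| \geq t$ for any $A, B \in \mathcal{A}$ (the case $A=B$ included). For a family $\mathcal{F}$ and a set $S$, $\mathcal{F}(S) := \{F \in \mathcal{F} \colon S \subseteq F\}$. If $T$ is a $t$-element subset of some set in $\mathcal{F}$, then $\mathcal{F}(T)$ is called a $t$-star of $\mathcal{F}$. The family $\mathcal{F}$ has the $t$-star property at the $t$-set $T$ if $\mathcal{F}(T)$ is a largest $t$-intersecting sub-family of $\mathcal{F}$, i.e. no $t$-intersecting sub-family of $\mathcal{F}$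 has more sets than $\mathcal{F}(T)$. The family $\mathcal{F}$ has the strict $t$-star property if either $\mathcal{F}$ has no (non-empty) $t$-intersecting sub-families (equivalently, all sets in $\mathcal{F}$ have size less than $t$) or all the largest $t$-intersecting sub-families of $\mathcal{F}$ are $t$-stars. *)

theory Defs
  imports Complex_Main
begin

text \<open>Families are of type \<^typ>\<open>'a set set\<close>. The notions below compare cardinalities with
  \<^const>\<open>card\<close> and are meant for finite families of finite sets only.\<close>

definition t_intersecting :: "nat \<Rightarrow> 'a set set \<Rightarrow> bool" where
  "t_intersecting t \<A> \<longleftrightarrow> (\<forall>A\<in>\<A>. \<forall>B\<in>\<A>. t \<le> card (A \<inter> B))"

definition subfamily_at :: "'a set set \<Rightarrow> 'a set \<Rightarrow> 'a set set" where
  "subfamily_at \<F> S = {F \<in> \<F>. S \<subseteq> F}"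

definition is_t_star :: "nat \<Rightarrow> 'a set set \<Rightarrow> 'a set set \<Rightarrow> bool" where
  "is_t_star t \<F> \<S> \<longleftrightarrow>
     (\<exists>T. finite T \<and> card T = t \<and> (\<exists>F\<in>\<F>. T \<subseteq> F) \<and> \<S> = subfamily_at \<F> T)"

definition is_largest_t_intersecting :: "nat \<Rightarrow> 'a set set \<Rightarrow> 'a set set \<Rightarrow> bool" where
  "is_largest_t_intersecting t \<F> \<A> \<longleftrightarrow>
     \<A> \<subseteq> \<F> \<and> t_intersecting t \<A> \<and>
     (\<forall>\<B>. \<B> \<subseteq> \<F> \<and> t_intersecting t \<B> \<longrightarrow> card \<B> \<le> card \<A>)"

definition t_star_property_at :: "nat \<Rightarrow> 'a set set \<Rightarrow> 'a set \<Rightarrow> bool" where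
  "t_star_property_at t \<F> T \<longleftrightarrow>
     finite T \<and> card T = t \<and> is_largest_t_intersecting t \<F> (subfamily_at \<F> T)"

definition strict_t_star_property :: "nat \<Rightarrow> 'a set set \<Rightarrow> bool" where
  "strict_t_star_property t \<F> \<longleftrightarrow>
     \<not> (\<exists>\<A>. \<A> \<subseteq> \<F> \<and> \<A> \<noteq> {} \<and> t_intersecting t \<A>) \<or>
     (\<forall>\<A>. is_largest_t_intersecting t \<F> \<A> \<longrightarrow> is_t_star t \<F> \<A>)"

text \<open>The tuple \<open>(k\<^sub>1, \<dots>, k\<^sub>n)\<close> is a function \<open>k\<close> of which only the values on \<open>{1..n}\<close> are used.
  The set \<open>{(x\<^sub>1, y\<^bsub>x\<^sub>1\<^esub>), \<dots>, (x\<^sub>r, y\<^bsub>x\<^sub>r\<^esub>)}\<close> is the graph of the labelling \<open>y\<close> on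
  \<open>X = {x\<^sub>1, \<dots>, x\<^sub>r}\<close>.\<close>

definition labeled_sets :: "nat \<Rightarrow> (nat \<Rightarrow> nat) \<Rightarrow> nat \<Rightarrow> (nat \<times> nat) set set" where
  "labeled_sets n k r =
     {(\<lambda>x. (x, y x)) ` X | X y. X \<subseteq> {1..n} \<and> card X = r \<and> (\<forall>x\<in>X. y x \<in> {1..k x})}"

end

theory Submission
  imports Defs
begin

text \<open>If no \<open>t\<close>-set is contained in all members of a \<open>t\<close>-intersecting family of \<open>r\<close>-sets, then some
  set \<open>J\<close> with at most \<open>3r - 2t - 1\<close> elements meets every member in at least \<open>t + 1\<close> elements.
  So the family has at most \<open>C\<close> times as many members as a largest \<open>(t + 1)\<close>-star, where
  \<open>C = (3r - 2t - 1 choose t + 1)\<close>. Among the stars at \<open>s\<close>-sets, the one at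
  \<open>{(1,1), \<dots>, (s,1)}\<close> is largest because it leaves free the positions with the most labels.
  Finally, double counting shows that the \<open>t\<close>-star there is at least
  \<open>(n - t) / (r - t) \<ge> C + 1\<close> times as large as the \<open>(t + 1)\<close>-star.\<close>

section \<open>Labeled sets and their stars\<close>

text \<open>Trades the witnesses \<open>X\<close> and \<open>y\<close> for conditions on
  \<open>A\<close> alone, which can be checked directly after elements of \<open>A\<close> are moved
  or exchanged. Injectivity of \<open>fst\<close> is what makes \<open>A\<close> the graph of a
  labelling.\<close>

lemma labeled_sets_iff:
  assumes "1 \<le> r"
  shows "A \<in> labeled_sets n k r \<longleftrightarrow>
    A \<subseteq> (SIGMA x:{1..n}. {1..k x}) \<and> inj_on fst A \<and> card A = r"
proof
  assume "A \<in> labeled_sets n k r"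
  then obtain X y where A: "A = (\<lambda>x. (x, y x)) ` X" and X: "X \<subseteq> {1..n}" "card X = r"
    "\<forall>x\<in>X. y x \<in> {1..k x}"
    unfolding labeled_sets_def by blast
  have "card A = r"
    unfolding A X(2)[symmetric] by (rule card_image) (simp add: inj_on_def)
  with A X show "A \<subseteq> (SIGMA x:{1..n}. {1..k x}) \<and> inj_on fst A \<and> card A = r"
    by (auto simp: inj_on_def)
next
  assume *: "A \<subseteq> (SIGMA x:{1..n}. {1..k x}) \<and> inj_on fst A \<and> card A = r"
  define y where "y x = snd (the_inv_into A fst x)" for x
  have y: "y (fst p) = snd p" if "p \<in> A" for p
    using * that by (simp add: y_def the_inv_into_f_f)
  have "A = (\<lambda>x. (x, y x)) ` fst ` A"
    using y by (auto simp: image_iff) force+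
  moreover have "fst ` A \<subseteq> {1..n}" "card (fst ` A) = r" "\<forall>x\<in>fst ` A. y x \<in> {1..k x}"
    using * y by (auto simp: card_image)
  ultimately show "A \<in> labeled_sets n k r"
    unfolding labeled_sets_def by blast
qed

lemma finite_labeled_sets: "finite (labeled_sets n k r)"
proof (rule finite_subset)
  show "labeled_sets n k r \<subseteq> Pow (SIGMA x:{1..n}. {1..k x})"
    by (auto simp: labeled_sets_def)
qed simp

lemma finite_subfamily_at: "finite \<F> \<Longrightarrow> finite (subfamily_at \<F> S)"
  by (simp add: subfamily_at_def)

lemma t_intersecting_subfamily_at:
  assumes "\<And>F. F \<in> \<F> \<Longrightarrow> finite F"
  shows "t_intersecting (card T) (subfamily_at \<F> T)"
  using assms by (auto simp: t_intersecting_def subfamily_at_def intro!: card_mono)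

section \<open>Small kernels of nontrivial families\<close>

text \<open>If no two members meet in exactly \<open>t\<close> elements, any member serves as
  \<open>J\<close>. Otherwise take \<open>A\<close>, \<open>B\<close> with exactly \<open>t\<close>
  common elements, a member \<open>C\<close> that misses one of these, and \<open>J\<close> as the
  union of the three. A member with only \<open>t\<close> elements in \<open>J\<close> would have
  the same intersection with \<open>A\<close>, \<open>B\<close> and \<open>C\<close>, hence at least
  \<open>t\<close> elements in their common part, which is too small.\<close>

lemma nontrivial_t_intersecting_kernel:
  assumes r: "\<And>A. A \<in> \<A> \<Longrightarrow> finite A \<and> card A = r"
    and int: "t_intersecting t \<A>"
    and "\<A> \<noteq> {}"
    and nontriv: "\<And>T. card T = t \<Longrightarrow> \<exists>A\<in>\<A>. \<not> T \<subseteq> A"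
  obtains J where "t < r" "finite J" "card J \<le> 3 * r - 2 * t - 1"
    "\<And>A. A \<in> \<A> \<Longrightarrow> t + 1 \<le> card (A \<inter> J)"
proof (cases "\<exists>A\<in>\<A>. \<exists>B\<in>\<A>. card (A \<inter> B) = t")
  case False
  obtain J where J: "J \<in> \<A>" using \<open>\<A> \<noteq> {}\<close> by blast
  have *: "t + 1 \<le> card (A \<inter> J)" if "A \<in> \<A>" for A
    using False int that J unfolding t_intersecting_def
    by (metis Suc_eq_plus1 le_neq_implies_less Suc_leI)
  have "t < r" using *[OF J] r[OF J] by simp
  \<comment> \<open>The size bound holds because \<open>t < r\<close> gives
    \<open>r \<le> 3 * r - 2 * t - 1\<close>.\<close>
  then show thesis
    using that[of J] * r[OF J] by simp
next
  case True
  then obtain A B where A: "A \<in> \<A>" and B: "B \<in> \<A>" and AB: "card (A \<inter> B) = t" by blast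
  obtain C where C: "C \<in> \<A>" "\<not> A \<inter> B \<subseteq> C" using nontriv[OF AB] by blast
  note fin = r[OF A] r[OF B] r[OF C(1)]
  have t_le: "t \<le> card (D \<inter> E)" if "D \<in> \<A>" "E \<in> \<A>" for D E
    using int that unfolding t_intersecting_def by blast
  have "C \<inter> (A \<inter> B) \<subset> A \<inter> B" using C(2) by blast
  then have ABC: "card (C \<inter> (A \<inter> B)) < t"
    using psubset_card_mono[of "A \<inter> B"] fin AB by simp
  \<comment> \<open>Inside \<open>C\<close>, two sets of size at least \<open>t\<close> overlap in
    fewer than \<open>t\<close> elements, so their union has more than \<open>t\<close>.\<close>
  have "card (C \<inter> A) + card (C \<inter> B) = card (C \<inter> (A \<union> B)) + card (C \<inter> (A \<inter> B))"
    using card_Un_Int[of "C \<inter> A" "C \<inter> B"] fin by (simp add: Int_Un_distrib Int_ac)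
  then have C1: "t + 1 \<le> card (C \<inter> (A \<union> B))"
    using t_le[OF C(1) A] t_le[OF C(1) B] ABC by linarith
  moreover have "card (C \<inter> (A \<union> B)) \<le> card C"
    by (rule card_mono) (use fin in auto)
  ultimately have "t < r" using fin by simp
  have c2: "card A + card B = card (A \<union> B) + card (A \<inter> B)"
    using card_Un_Int fin by blast
  have c3: "card (A \<union> B) + card C = card (A \<union> B \<union> C) + card (C \<inter> (A \<union> B))"
    using card_Un_Int[of "A \<union> B" C] fin by (simp add: Int_commute)
  \<comment> \<open>The union of \<open>A\<close> and \<open>B\<close> has \<open>2 * r - t\<close>
    elements, and \<open>C\<close> adds at most \<open>r - t - 1\<close>.\<close>
  have cardJ: "card (A \<union> B \<union> C) \<le> 3 * r - 2 * t - 1"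
    using c2 c3 AB fin C1 by linarith
  have "t + 1 \<le> card (D \<inter> (A \<union> B \<union> C))" if D: "D \<in> \<A>" for D
  proof (rule ccontr)
    let ?K = "D \<inter> (A \<union> B \<union> C)"
    assume "\<not> t + 1 \<le> card ?K"
    then have small: "card ?K \<le> t" by simp
    have eq: "D \<inter> E = ?K" if "E \<in> {A, B, C}" for E
    proof (rule card_seteq)
      show "finite ?K" using fin by simp
      show "D \<inter> E \<subseteq> ?K" using that by blast
      show "card ?K \<le> card (D \<inter> E)"
        using that small t_le[OF D, of E] A B C(1) by auto
    qed
    have "?K \<subseteq> C \<inter> (A \<inter> B)" using eq[of A] eq[of B] eq[of C] by blast
    then have "card ?K \<le> card (C \<inter> (A \<inter> B))" by (rule card_mono[rotated]) (use fin in simp)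
    moreover have "t \<le> card ?K" using t_le[OF D A] eq[of A] by simp
    ultimately show False using ABC by simp
  qed
  then show thesis
    using that[of "A \<union> B \<union> C"] \<open>t < r\<close> cardJ fin by simp
qed

section \<open>Comparison of stars with those at initial positions\<close>

text \<open>The size is left open: \<open>t\<close> and \<open>t + 1\<close> give the two stars to
  be compared, and \<open>r\<close> gives a member of the family itself.\<close>

definition initial :: "nat \<Rightarrow> (nat \<times> nat) set" where
  "initial s = (\<lambda>i. (i, 1)) ` {1..s}"

lemma finite_initial [simp]: "finite (initial s)"
  and card_initial [simp]: "card (initial s) = s"
  and fst_initial [simp]: "fst ` initial s = {1..s}"
  and mem_initial [simp]: "(x, y) \<in> initial s \<longleftrightarrow> x \<in> {1..s} \<and> y = 1"
  and inj_on_fst_initial [simp]: "inj_on fst (initial s)"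
  by (auto simp: initial_def card_image inj_on_def image_image)

context
  fixes n r :: nat and k :: "nat \<Rightarrow> nat"
  assumes r_pos: "1 \<le> r" and r_le_n: "r \<le> n"
    and k_pos: "\<forall>i\<in>{1..n}. 1 \<le> k i"
begin

private abbreviation (input) \<L> :: "(nat \<times> nat) set set" where
  "\<L> \<equiv> labeled_sets n k r"

lemma finite_labeled_set: "A \<in> \<L> \<Longrightarrow> finite A"
  using r_pos labeled_sets_iff[OF r_pos] card_ge_0_finite[of A] by auto

lemma initial_in_labeled_sets: "initial r \<in> \<L>"
  using r_le_n k_pos by (auto simp: labeled_sets_iff[OF r_pos])

lemma initial_in_star: "s \<le> r \<Longrightarrow> initial r \<in> subfamily_at \<L> (initial s)"
  using initial_in_labeled_sets by (auto simp: subfamily_at_def)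

lemma card_star_initial_pos: "s \<le> r \<Longrightarrow> 0 < card (subfamily_at \<L> (initial s))"
  using initial_in_star finite_subfamily_at[OF finite_labeled_sets] card_gt_0_iff by fastforce

text \<open>Replacing \<open>S\<close> by \<open>initial s\<close> vacates the positions in
  \<open>X - {1..s}\<close> and claims those in \<open>{1..s} - X\<close>. Elements of
  \<open>A - S\<close> sitting at claimed positions move to vacated ones and keep their labels. Such
  a move goes to a larger position, where by monotonicity of \<open>k\<close> the label is still
  allowed, and it can be undone.\<close>

lemma card_star_le_initial:
  assumes mono: "mono_on {1..n} k"
    and S: "card S = s" and F: "F \<in> \<L>" "S \<subseteq> F"
  shows "card (subfamily_at \<L> S) \<le> card (subfamily_at \<L> (initial s))"
proof -
  note iff = labeled_sets_iff[OF r_pos]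
  have finS: "finite S" using F finite_labeled_set finite_subset by blast
  have sr: "s \<le> r" using F S iff finite_labeled_set card_mono by metis
  define X where "X = fst ` S"
  have X: "X \<subseteq> {1..n}" "finite X" "card X = s"
    using F S finS unfolding X_def iff by (auto simp: card_image inj_on_subset)
  have "card ({1..s} - X) = card (X - {1..s})"
    using X card_Diff_subset_Int[of "{1..s}" X] card_Diff_subset_Int[of X "{1..s}"]
    by (simp add: Int_commute)
  then obtain \<beta> where \<beta>: "bij_betw \<beta> ({1..s} - X) (X - {1..s})"
    using X finite_same_card_bij[of "{1..s} - X" "X - {1..s}"] by auto
  \<comment> \<open>Only positions outside \<open>X\<close> get relocated, so \<beta> is evaluated
    only on \<open>{1..s} - X\<close>.\<close>
  define \<sigma> where "\<sigma> x = (if x \<in> {1..s} then \<beta> x else x)" for x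
  have \<beta>_in: "\<beta> x \<in> X - {1..s}" if "x \<in> {1..s} - X" for x
    using \<beta> that by (rule bij_betwE[rule_format])
  have \<sigma>_range: "\<sigma> x \<in> {1..n} - {1..s}" "k x \<le> k (\<sigma> x)" if "x \<in> {1..n} - X" for x
    using that \<beta>_in[of x] X mono_onD[OF mono, of x "\<beta> x"] by (auto simp: \<sigma>_def)
  \<comment> \<open>Moved positions land in \<open>X\<close>, while fixed ones stay outside
    \<open>X\<close>, so the two kinds cannot collide.\<close>
  have \<sigma>_inj: "inj_on \<sigma> ({1..n} - X)"
    unfolding inj_on_def
  proof (intro ballI impI)
    fix x y assume "x \<in> {1..n} - X" "y \<in> {1..n} - X" "\<sigma> x = \<sigma> y"
    then show "x = y"
      using \<beta>_in[of x] \<beta>_in[of y] bij_betw_imp_inj_on[OF \<beta>, THEN inj_onD, of x y]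
      by (auto simp: \<sigma>_def split: if_splits)
  qed
  define h where "h A = map_prod \<sigma> id ` (A - S)" for A :: "(nat \<times> nat) set"
  have rest: "fst p \<in> {1..n} - X" if "A \<in> subfamily_at \<L> S" "p \<in> A - S" for A p
  proof -
    have "A \<subseteq> (SIGMA x:{1..n}. {1..k x})" "inj_on fst A" "S \<subseteq> A"
      using that(1) by (auto simp: subfamily_at_def iff)
    then show ?thesis
      using that(2) unfolding X_def by (auto simp: inj_on_def)
  qed
  have h_fst: "fst p \<notin> {1..s}" if "A \<in> subfamily_at \<L> S" "p \<in> h A" for A p
    using that rest[of A] \<sigma>_range(1) unfolding h_def by fastforce
  have map_inj: "inj_on (map_prod \<sigma> id) (({1..n} - X) \<times> UNIV)"
    using \<sigma>_inj by (intro map_prod_inj_on) auto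
  have sub: "A - S \<subseteq> ({1..n} - X) \<times> UNIV" if "A \<in> subfamily_at \<L> S" for A
    using rest[OF that] by (auto simp: mem_Times_iff)
  show ?thesis
  proof (rule card_inj_on_le)
    show "inj_on (\<lambda>A. initial s \<union> h A) (subfamily_at \<L> S)"
    proof (rule inj_onI)
      fix A B
      assume A: "A \<in> subfamily_at \<L> S" and B: "B \<in> subfamily_at \<L> S"
        and eq: "initial s \<union> h A = initial s \<union> h B"
      \<comment> \<open>The positions beyond \<open>s\<close> single out \<open>h A\<close> within
        the image, and \<open>h A\<close> determines \<open>A - S\<close>.\<close>
      have "h A = {p \<in> initial s \<union> h A. fst p \<notin> {1..s}}"
        using h_fst[OF A] by auto
      also have "\<dots> = h B"
        unfolding eq using h_fst[OF B] by auto
      finally have "A - S = B - S"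
        using inj_on_image_eq_iff[OF map_inj sub[OF A] sub[OF B]] unfolding h_def by simp
      moreover have "S \<subseteq> A" "S \<subseteq> B" using A B by (auto simp: subfamily_at_def)
      ultimately show "A = B" by blast
    qed
    show "(\<lambda>A. initial s \<union> h A) ` subfamily_at \<L> S \<subseteq> subfamily_at \<L> (initial s)"
    proof (rule image_subsetI)
      fix A assume A: "A \<in> subfamily_at \<L> S"
      then have AL: "A \<subseteq> (SIGMA x:{1..n}. {1..k x})" "inj_on fst A" "card A = r" "S \<subseteq> A"
        by (auto simp: subfamily_at_def iff)
      have finA: "finite A" using A finite_labeled_set by (simp add: subfamily_at_def)
      have "h A \<subseteq> (SIGMA x:{1..n}. {1..k x})"
      proof
        fix p assume "p \<in> h A"
        then obtain q where q: "q \<in> A - S" "p = (\<sigma> (fst q), snd q)"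
          unfolding h_def by (auto simp: map_prod_def split: prod.splits)
        have "snd q \<le> k (fst q)" "1 \<le> snd q" using q(1) AL(1) by auto
        then show "p \<in> (SIGMA x:{1..n}. {1..k x})"
          using \<sigma>_range[OF rest[OF A q(1)]] q(2) by auto
      qed
      moreover have "initial s \<subseteq> (SIGMA x:{1..n}. {1..k x})"
        using sr r_le_n k_pos by auto
      moreover have "inj_on fst (h A)"
      proof (rule inj_onI)
        fix p q assume "p \<in> h A" "q \<in> h A" and eq: "fst p = fst q"
        then obtain p' q' where p': "p' \<in> A - S" "p = map_prod \<sigma> id p'"
          and q': "q' \<in> A - S" "q = map_prod \<sigma> id q'"
          unfolding h_def by (meson imageE)
        have "fst p' = fst q'"
          using eq p' q' inj_onD[OF \<sigma>_inj _ rest[OF A] rest[OF A], of p' q'] by simp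
        then have "p' = q'" using AL(2) p' q' by (auto dest: inj_onD)
        then show "p = q" using p' q' by simp
      qed
      moreover have "fst ` (initial s - h A) \<inter> fst ` (h A - initial s) = {}"
        using h_fst[OF A] by fastforce
      moreover have "initial s \<inter> h A = {}"
        using h_fst[OF A] by fastforce
      moreover have "card (h A) = r - s"
        using card_image[OF inj_on_subset[OF map_inj sub[OF A]]] AL S finS
        by (simp add: h_def card_Diff_subset)
      moreover have "finite (h A)" using finA by (simp add: h_def)
      ultimately have "initial s \<union> h A \<in> \<L>"
        using sr by (simp add: iff inj_on_Un card_Un_disjoint)
      then show "initial s \<union> h A \<in> subfamily_at \<L> (initial s)"
        by (simp add: subfamily_at_def)
    qed
  qed (simp add: finite_subfamily_at finite_labeled_sets)
qed

text \<open>If \<open>A\<close> does not occupy \<open>x\<close>, exchange \<open>(t + 1, 1)\<close>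
  for \<open>(x, 1)\<close>; the label 1 is available at every position. Otherwise keep
  \<open>A\<close>.\<close>

lemma card_star_Suc_le_through:
  assumes x: "x \<in> {t + 1..n}"
  shows "card (subfamily_at \<L> (initial (t + 1)))
    \<le> card {A \<in> subfamily_at \<L> (initial t). x \<in> fst ` A}"
proof (rule card_inj_on_le)
  note iff = labeled_sets_iff[OF r_pos]
  let ?a = "(t + 1, 1) :: nat \<times> nat"
  define g where "g A = (if x \<in> fst ` A then A else insert (x, 1) (A - {?a}))"
    for A :: "(nat \<times> nat) set"
  have mem: "?a \<in> A" "A \<in> \<L>" "initial t \<subseteq> A" "inj_on fst A"
    if "A \<in> subfamily_at \<L> (initial (t + 1))" for A
    using that by (auto simp: subfamily_at_def iff)
  show "inj_on g (subfamily_at \<L> (initial (t + 1)))"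
  proof (rule inj_onI)
    fix A B assume A: "A \<in> subfamily_at \<L> (initial (t + 1))"
      and B: "B \<in> subfamily_at \<L> (initial (t + 1))" and eq: "g A = g B"
    \<comment> \<open>Whether \<open>?a\<close> survives reveals which case of \<open>g\<close> was
      applied, so \<open>g\<close> can be inverted.\<close>
    have gA: "?a \<in> g A' \<longleftrightarrow> x \<in> fst ` A'" if "A' \<in> subfamily_at \<L> (initial (t + 1))" for A'
      using mem(1)[OF that] by (auto simp: g_def image_iff)
    show "A = B"
    proof (cases "x \<in> fst ` A")
      case True
      then show ?thesis using gA[OF A] gA[OF B] eq by (simp add: g_def)
    next
      case False
      then have B': "x \<notin> fst ` B" using gA[OF A] gA[OF B] eq by simp
      have "A' - {?a} = g A' - {(x, 1)}" if "x \<notin> fst ` A'" for A'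
      proof -
        have "(x, 1) \<notin> A'" using that by force
        then show ?thesis using that by (auto simp: g_def)
      qed
      then have "A - {?a} = B - {?a}" using eq False B' by simp
      then show ?thesis using mem(1)[OF A] mem(1)[OF B] by blast
    qed
  qed
  show "g ` subfamily_at \<L> (initial (t + 1)) \<subseteq> {A \<in> subfamily_at \<L> (initial t). x \<in> fst ` A}"
  proof (rule image_subsetI)
    fix A assume A: "A \<in> subfamily_at \<L> (initial (t + 1))"
    note m = mem[OF A]
    show "g A \<in> {A \<in> subfamily_at \<L> (initial t). x \<in> fst ` A}"
    proof (cases "x \<in> fst ` A")
      case True
      then show ?thesis using m by (simp add: g_def subfamily_at_def)
    next
      case False
      then have "(x, 1) \<notin> A" by force
      then have "card (g A) = r"
        using m(1,2) False finite_labeled_set[OF m(2)] r_pos by (simp add: g_def iff)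
      moreover have "g A \<subseteq> (SIGMA x:{1..n}. {1..k x})"
        using m(2) x k_pos False by (auto simp: g_def iff)
      moreover have "inj_on fst (g A)"
        using False m(4) by (auto simp: g_def inj_on_def)
      moreover have "initial t \<subseteq> g A"
        using m(3) False by (auto simp: g_def)
      ultimately show ?thesis
        using False by (auto simp: subfamily_at_def iff g_def)
    qed
  qed
qed (simp add: finite_subfamily_at finite_labeled_sets)

text \<open>Double counting of the pairs of a member \<open>A\<close> of the \<open>t\<close>-star and a position \<open>x > t\<close> occupied
  by \<open>A\<close>.\<close>

lemma card_star_Suc_bound:
  "(n - t) * card (subfamily_at \<L> (initial (t + 1)))
    \<le> (r - t) * card (subfamily_at \<L> (initial t))"
proof -
  let ?G = "subfamily_at \<L> (initial t)"
  have fin: "finite ?G" by (simp add: finite_subfamily_at finite_labeled_sets)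
  have "(n - t) * card (subfamily_at \<L> (initial (t + 1)))
      = (\<Sum>x\<in>{t + 1..n}. card (subfamily_at \<L> (initial (t + 1))))"
    by simp
  also have "\<dots> \<le> (\<Sum>x\<in>{t + 1..n}. card {A \<in> ?G. x \<in> fst ` A})"
    by (rule sum_mono) (rule card_star_Suc_le_through)
  also have "\<dots> = (\<Sum>A\<in>?G. card {x \<in> {t + 1..n}. x \<in> fst ` A})"
    by (rule sum_multicount_gen) (use fin in auto)
  \<comment> \<open>Of the \<open>r\<close> distinct positions of \<open>A\<close>, exactly
    \<open>t\<close> are taken up by \<open>initial t\<close>.\<close>
  also have "\<dots> = (\<Sum>A\<in>?G. r - t)"
  proof (rule sum.cong)
    fix A assume A: "A \<in> ?G"
    then have AL: "A \<subseteq> (SIGMA x:{1..n}. {1..k x})" "inj_on fst A" "card A = r" "initial t \<subseteq> A"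
      by (auto simp: subfamily_at_def labeled_sets_iff[OF r_pos])
    have "{1..t} \<subseteq> fst ` A" using image_mono[OF AL(4), of fst] by simp
    moreover have "{x \<in> {t + 1..n}. x \<in> fst ` A} = fst ` A - {1..t}"
      using AL(1) by auto
    ultimately show "card {x \<in> {t + 1..n}. x \<in> fst ` A} = r - t"
      using AL(2,3) by (simp add: card_Diff_subset card_image)
  qed simp
  finally show ?thesis by (simp add: mult.commute)
qed

section \<open>Nontrivial families are smaller than the star\<close>

text \<open>The stars at the \<open>(t + 1)\<close>-subsets of a kernel \<open>J\<close> cover the
  family. There are at most \<open>?C\<close> of them, each of size at most \<open>?m\<close>,
  whereas the \<open>t\<close>-star has size at least \<open>(?C + 1) * ?m\<close>.\<close>

lemma card_nontrivial_less:
  assumes mono: "mono_on {1..n} k"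
    and large: "(r - t) * ((3 * r - 2 * t - 1) choose (t + 1)) + r \<le> n"
    and \<A>: "\<A> \<subseteq> \<L>" "t_intersecting t \<A>" "\<A> \<noteq> {}"
    and nontriv: "\<And>T. card T = t \<Longrightarrow> \<exists>A\<in>\<A>. \<not> T \<subseteq> A"
  shows "card \<A> < card (subfamily_at \<L> (initial t))"
proof -
  have mem: "finite A \<and> card A = r" if "A \<in> \<A>" for A
    using that \<A>(1) finite_labeled_set by (auto simp: labeled_sets_iff[OF r_pos])
  obtain J where tr: "t < r" and J: "finite J" "card J \<le> 3 * r - 2 * t - 1"
    and meet: "\<And>A. A \<in> \<A> \<Longrightarrow> t + 1 \<le> card (A \<inter> J)"
    using nontrivial_t_intersecting_kernel[OF mem \<A>(2,3) nontriv] by blast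
  let ?C = "(3 * r - 2 * t - 1) choose (t + 1)"
  let ?m = "card (subfamily_at \<L> (initial (t + 1)))"
  let ?P = "{S. S \<subseteq> J \<and> card S = t + 1}"
  have finP: "finite ?P" using J(1) by simp
  have "\<A> \<subseteq> (\<Union>S\<in>?P. subfamily_at \<L> S)"
  proof
    fix A assume A: "A \<in> \<A>"
    obtain S where "S \<subseteq> A \<inter> J" "card S = t + 1"
      using obtain_subset_with_card_n[OF meet[OF A]] by blast
    then show "A \<in> (\<Union>S\<in>?P. subfamily_at \<L> S)"
      using A \<A>(1) by (auto simp: subfamily_at_def)
  qed
  then have "card \<A> \<le> card (\<Union>S\<in>?P. subfamily_at \<L> S)"
    using finP by (intro card_mono) (simp_all add: finite_subfamily_at finite_labeled_sets)
  also have "\<dots> \<le> (\<Sum>S\<in>?P. card (subfamily_at \<L> S))"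
    by (rule card_UN_le[OF finP])
  also have "\<dots> \<le> (\<Sum>S\<in>?P. ?m)"
  proof (rule sum_mono)
    fix S assume S: "S \<in> ?P"
    show "card (subfamily_at \<L> S) \<le> ?m"
    \<comment> \<open>Subsets of \<open>J\<close> need not extend to labeled sets, and the
      comparison of stars applies only to those that do.\<close>
    proof (cases "subfamily_at \<L> S = {}")
      case False
      then obtain F where "F \<in> \<L>" "S \<subseteq> F" by (auto simp: subfamily_at_def)
      then show ?thesis using card_star_le_initial[OF mono] S by blast
    qed simp
  qed
  also have "\<dots> = (card J choose (t + 1)) * ?m"
    using n_subsets[OF J(1)] by simp
  also have "\<dots> \<le> ?C * ?m"
    using J(2) by (intro mult_right_mono binomial_right_mono) auto
  finally have le: "card \<A> \<le> ?C * ?m" .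
  \<comment> \<open>Positivity makes the final inequality strict; it needs
    \<open>t + 1 \<le> r\<close>, which the kernel lemma supplies.\<close>
  have "?m > 0" using card_star_initial_pos tr by simp
  have "(r - t) * (?C + 1) \<le> n - t"
    using large tr by (simp add: algebra_simps)
  then have "(r - t) * ((?C + 1) * ?m) \<le> (n - t) * ?m"
    by (metis mult.assoc mult_le_mono1)
  also have "\<dots> \<le> (r - t) * card (subfamily_at \<L> (initial t))"
    by (rule card_star_Suc_bound)
  finally have "(?C + 1) * ?m \<le> card (subfamily_at \<L> (initial t))"
    using tr by simp
  with le \<open>?m > 0\<close> show ?thesis by simp
qed

end

section \<open>Optimality and uniqueness of stars\<close>

theorem theorem5p5:
  fixes t r n :: nat and k :: "nat \<Rightarrow> nat"
  assumes "1 \<le> t" and "t \<le> r"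
    and "n \<ge> (r - t) * ((3 * r - 2 * t - 1) choose (t + 1)) + r"
    and "\<And>i. i \<in> {1..n} \<Longrightarrow> 1 \<le> k i"
    and "\<And>i j. 1 \<le> i \<Longrightarrow> i \<le> j \<Longrightarrow> j \<le> n \<Longrightarrow> k i \<le> k j"
  shows "t_star_property_at t (labeled_sets n k r) ((\<lambda>i. (i, 1)) ` {1..t})
    \<and> strict_t_star_property t (labeled_sets n k r)"
proof -
  let ?L = "labeled_sets n k r"
  let ?S = "subfamily_at ?L (initial t)"
  have r: "1 \<le> r" "r \<le> n" using assms(1-3) by auto
  have pos: "\<forall>i\<in>{1..n}. 1 \<le> k i" using assms(4) by blast
  have mono: "mono_on {1..n} k" using assms(5) by (auto intro!: mono_onI)
  note ctx = r pos
  have finL: "finite A" if "A \<in> ?L" for A using finite_labeled_set[OF ctx that] .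
  have S_int: "t_intersecting t ?S"
    using t_intersecting_subfamily_at[of ?L "initial t"] finL by simp
  have S_ne: "card ?S > 0"
    by (rule card_star_initial_pos[OF ctx assms(2)])
  \<comment> \<open>The empty family falls under the first alternative, since \<open>?S\<close> is
    nonempty; a nonempty one either has no common \<open>t\<close>-set or lies in a star.\<close>
  have dichotomy: "card \<B> < card ?S \<or>
      (\<exists>T. card T = t \<and> (\<exists>F\<in>?L. T \<subseteq> F) \<and> \<B> \<subseteq> subfamily_at ?L T)"
    if \<B>: "\<B> \<subseteq> ?L" "t_intersecting t \<B>" for \<B>
  proof (cases "\<B> = {} \<or> (\<forall>T. card T = t \<longrightarrow> (\<exists>A\<in>\<B>. \<not> T \<subseteq> A))")
    case True
    then show ?thesis
      using card_nontrivial_less[OF ctx mono assms(3) \<B>] S_ne by (metis card.empty)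
  next
    case False
    then obtain T where "card T = t" "\<forall>A\<in>\<B>. T \<subseteq> A" "\<B> \<noteq> {}" by blast
    then show ?thesis using \<B>(1) unfolding subfamily_at_def by blast
  qed
  have le: "card \<B> \<le> card ?S" if \<B>: "\<B> \<subseteq> ?L" "t_intersecting t \<B>" for \<B>
    using dichotomy[OF \<B>]
  proof
    assume "\<exists>T. card T = t \<and> (\<exists>F\<in>?L. T \<subseteq> F) \<and> \<B> \<subseteq> subfamily_at ?L T"
    then obtain T F where T: "card T = t" "F \<in> ?L" "T \<subseteq> F" "\<B> \<subseteq> subfamily_at ?L T" by blast
    have "card \<B> \<le> card (subfamily_at ?L T)"
      using T(4) by (rule card_mono[OF finite_subfamily_at[OF finite_labeled_sets]])
    also have "\<dots> \<le> card ?S"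
      using card_star_le_initial[OF ctx mono T(1-3)] by blast
    finally show ?thesis .
  qed simp
  have S_sub: "?S \<subseteq> ?L" by (auto simp: subfamily_at_def)
  have "is_t_star t ?L \<A>" if "is_largest_t_intersecting t ?L \<A>" for \<A>
  proof -
    have \<A>: "\<A> \<subseteq> ?L" "t_intersecting t \<A>"
      and max: "\<And>\<B>. \<B> \<subseteq> ?L \<Longrightarrow> t_intersecting t \<B> \<Longrightarrow> card \<B> \<le> card \<A>"
      using that unfolding is_largest_t_intersecting_def by auto
    have "card ?S \<le> card \<A>" by (rule max[OF S_sub S_int])
    then obtain T where T: "card T = t" "\<exists>F\<in>?L. T \<subseteq> F" "\<A> \<subseteq> subfamily_at ?L T"
      using dichotomy[OF \<A>] by auto
    \<comment> \<open>The star at \<open>T\<close> is itself \<open>t\<close>-intersecting, so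
      maximality of \<open>\<A>\<close> forces equality with the star containing it.\<close>
    have "card (subfamily_at ?L T) \<le> card \<A>"
      using T(1) t_intersecting_subfamily_at[of ?L T] finL
      by (intro max) (auto simp: subfamily_at_def)
    then have "\<A> = subfamily_at ?L T"
      by (rule card_seteq[OF finite_subfamily_at[OF finite_labeled_sets] T(3)])
    \<comment> \<open>An infinite \<open>T\<close> would have cardinality 0, contrary to
      \<open>t \<ge> 1\<close>.\<close>
    moreover have "finite T" using T(1) assms(1) card_ge_0_finite[of T] by simp
    ultimately show ?thesis using T(1,2) unfolding is_t_star_def by blast
  qed
  then have "strict_t_star_property t ?L"
    unfolding strict_t_star_property_def by blast
  moreover have "t_star_property_at t ?L (initial t)"
    using S_sub S_int le
    by (simp add: t_star_property_at_def is_largest_t_intersecting_def)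
  ultimately show ?thesis by (simp add: initial_def)
qed

end
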